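(* Let $F(z)=\sum_{n=-\infty}^\infty a_nz^n$ be a holomorphic function in a punctured neighborhood of $\infty$. The Toeplitz operator $T_F:H(\mathbb{C})\to H(\mathbb{C})$ is (i) strongly tame, and hence m-topologizable, if $\sum_{n=1}^\infty|a_{-n+1}|<\infty$; (ii) power bounded if $\sup_{p\in\mathbb{N}}\left(\sum_{n=1}^\infty|a_n|e^{pn}\right)+\sum_{n\in\mathbb{N}}|a_{-n+1}|\le1$.
   Context: $\mathbb{N}=\{1,2,\dots\}$. $H(\mathbb{C})$ is the Fréchet space of entire functions, identified with the power series space $\Lambda_\infty(n)=\{x=(x_n)_{n\in\mathbb{N}}:\|x\|_k:=\sum_{n=1}^\infty|x_n|e^{kn}<\infty\ \forall k\in\mathbb{N}\}$ via Taylor coefficients at $0$, $z^{n-1}\leftrightarrow e_n$; so its seminorms are $\|f\|_k=\sum_{n=1}^\infty|f_{n-1}|e^{kn}$ for $f(z)=\sum_{n\ge0}f_nz^n$, $k\in\mathbb{N}$. Toeplitz operator: let $U$ be an open simply connected neighborhood of $\infty$ in the Riemann sphere and $F$ holomorphic in $U\setminus\{\infty\}$, with $a_n$ ($n\in\mathbb{Z}$) the Laurent coefficients of $F$ (expansion centered at $0$, valid for $|z|$ large). For $f\in H(\mathbb{C})$ and $z\in\mathbb{C}$, $$(T_Ff)(z)=\frac1{2\pi i}\int_\gamma\frac{F(\xi)f(\xi)}{\xi-z}\,d\xi,$$ where $\gamma\subset U\setminus\{\infty\}$ is a $C^\infty$ smooth Jordan curve whose interior contains $z$ and $\mathbb{C}\setminus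 U$ (the value is independent of the choice of $\gamma$). $T_F$ is a continuous linear operator on $H(\mathbb{C})$, and its matrix with respect to $(z^n)_{n\ge0}$ is the Toeplitz matrix $(a_{i-j})_{i,j\ge0}$. A linear operator $T$ on a Fréchet space $E$ with increasing seminorms $(\|\cdot\|_p)_{p\in\mathbb{N}}$ is strongly tame if for every $p\in\mathbb{N}$ there is $C_p>0$ with $\|Tx\|_p\le C_p\|x\|_p$ for all $x\in E$; a continuous linear $T$ is m-topologizable if for every $p\in\mathbb{N}$ there exist $q\in\mathbb{N}$ and $C_p\ge1$ with $\|T^kx\|_p\le C_p^k\|x\|_q$ for all $k\in\mathbb{N}$, $x\in E$; it is power bounded if for every $p\in\mathbb{N}$ there exist $q\in\mathbb{N}$ and $C_p\ge1$ with $\|T^kx\|_p\le C_p\|x\|_q$ for all $k\in\mathbb{N}$, $x\in E$. *)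

theory Defs
  imports
    "HOL-Complex_Analysis.Complex_Analysis"
    "HOL-Library.Function_Algebras"
begin

section \<open>Operators on spaces with a sequence of seminorms\<close>

text \<open>
  A space is given by a carrier set \<open>E\<close> in an abelian group, a scalar multiplication \<open>s\<close> and
  seminorms \<open>nrm p\<close>. All seminorm indices and all exponents range over the positive integers;
  the value \<open>nrm 0\<close> is never used.
\<close>

definition linear_operator_on ::
    "('k::field \<Rightarrow> 'v::ab_group_add \<Rightarrow> 'v) \<Rightarrow> 'v set \<Rightarrow> ('v \<Rightarrow> 'v) \<Rightarrow> bool" where
  "linear_operator_on s E T \<longleftrightarrow>
     T ` E \<subseteq> E \<and>
     (\<forall>x\<in>E. \<forall>y\<in>E. T (x + y) = T x + T y) \<and>
     (\<forall>c. \<forall>x\<in>E. T (s c x) = s c (T x))"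

definition seminorm_topology ::
    "'v::ab_group_add set \<Rightarrow> (nat \<Rightarrow> 'v \<Rightarrow> real) \<Rightarrow> 'v topology" where
  "seminorm_topology E nrm =
     topology_generated_by
       {{y \<in> E. nrm p (y - x) < e} | p x e. p \<ge> 1 \<and> x \<in> E \<and> e > 0}"

definition continuous_linear_operator_on ::
    "('k::field \<Rightarrow> 'v::ab_group_add \<Rightarrow> 'v) \<Rightarrow> 'v set \<Rightarrow> (nat \<Rightarrow> 'v \<Rightarrow> real) \<Rightarrow> ('v \<Rightarrow> 'v) \<Rightarrow> bool"
  where
  "continuous_linear_operator_on s E nrm T \<longleftrightarrow>
     linear_operator_on s E T \<and>
     continuous_map (seminorm_topology E nrm) (seminorm_topology E nrm) T"

definition strongly_tame ::
    "('k::field \<Rightarrow> 'v::ab_group_add \<Rightarrow> 'v) \<Rightarrow> 'v set \<Rightarrow> (nat \<Rightarrow> 'v \<Rightarrow> real) \<Rightarrow> ('v \<Rightarrow> 'v) \<Rightarrow> bool"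
  where
  "strongly_tame s E nrm T \<longleftrightarrow>
     linear_operator_on s E T \<and>
     (\<forall>p\<ge>1. \<exists>C>0. \<forall>x\<in>E. nrm p (T x) \<le> C * nrm p x)"

definition m_topologizable ::
    "('k::field \<Rightarrow> 'v::ab_group_add \<Rightarrow> 'v) \<Rightarrow> 'v set \<Rightarrow> (nat \<Rightarrow> 'v \<Rightarrow> real) \<Rightarrow> ('v \<Rightarrow> 'v) \<Rightarrow> bool"
  where
  "m_topologizable s E nrm T \<longleftrightarrow>
     continuous_linear_operator_on s E nrm T \<and>
     (\<forall>p\<ge>1. \<exists>q\<ge>1. \<exists>C\<ge>1. \<forall>k\<ge>1. \<forall>x\<in>E. nrm p ((T ^^ k) x) \<le> C ^ k * nrm q x)"

definition power_bounded ::
    "('k::field \<Rightarrow> 'v::ab_group_add \<Rightarrow> 'v) \<Rightarrow> 'v set \<Rightarrow> (nat \<Rightarrow> 'v \<Rightarrow> real) \<Rightarrow> ('v \<Rightarrow> 'v) \<Rightarrow> bool"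
  where
  "power_bounded s E nrm T \<longleftrightarrow>
     continuous_linear_operator_on s E nrm T \<and>
     (\<forall>p\<ge>1. \<exists>q\<ge>1. \<exists>C\<ge>1. \<forall>k\<ge>1. \<forall>x\<in>E. nrm p ((T ^^ k) x) \<le> C * nrm q x)"


section \<open>The space of entire functions\<close>

definition entire :: "(complex \<Rightarrow> complex) set" where
  "entire = {f. f holomorphic_on UNIV}"

definition scale_fun :: "complex \<Rightarrow> (complex \<Rightarrow> complex) \<Rightarrow> complex \<Rightarrow> complex" where
  "scale_fun c f = (\<lambda>z. c * f z)"

definition taylor_coeff :: "(complex \<Rightarrow> complex) \<Rightarrow> nat \<Rightarrow> complex" where
  "taylor_coeff f n = (deriv ^^ n) f 0 / fact n"

text \<open>
  The coefficient of \<open>z^n\<close> carries the weight \<open>exp (k * (n + 1))\<close>, because \<open>z^(n-1)\<close>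
  corresponds to the \<open>n\<close>-th unit vector of the power series space, \<open>n\<close> starting at 1.
\<close>

definition entire_norm :: "nat \<Rightarrow> (complex \<Rightarrow> complex) \<Rightarrow> real" where
  "entire_norm k f = (\<Sum>n. norm (taylor_coeff f n) * exp (real k * real (Suc n)))"


section \<open>Neighbourhoods of infinity in the Riemann sphere\<close>

abbreviation riemann_sphere :: "complex option topology" where
  "riemann_sphere \<equiv> Alexandroff_compactification euclidean"

text \<open>The library's \<^const>\<open>simply_connected\<close>, transferred to subsets of an abstract topology.\<close>

definition simply_connected_in :: "'a topology \<Rightarrow> 'a set \<Rightarrow> bool" where
  "simply_connected_in X S \<longleftrightarrow>
     S \<subseteq> topspace X \<and>
     (\<forall>p q. pathin (subtopology X S) p \<and> p 1 = p 0 \<and>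
            pathin (subtopology X S) q \<and> q 1 = q 0
        \<longrightarrow> homotopic_with (\<lambda>r. r 1 = r 0)
              (subtopology euclidean {0..1}) (subtopology X S) p q)"

definition simply_connected_nhd_infinity :: "complex option set \<Rightarrow> bool" where
  "simply_connected_nhd_infinity U \<longleftrightarrow>
     openin riemann_sphere U \<and> None \<in> U \<and> simply_connected_in riemann_sphere U"

definition finite_part :: "complex option set \<Rightarrow> complex set" where
  "finite_part U = {z. Some z \<in> U}"

definition laurent_at_infinity :: "(complex \<Rightarrow> complex) \<Rightarrow> (int \<Rightarrow> complex) \<Rightarrow> bool" where
  "laurent_at_infinity F a \<longleftrightarrow>
     eventually (\<lambda>z. ((\<lambda>n. a n * z powi n) has_sum F z) UNIV) at_infinity"


section \<open>Toeplitz operators\<close>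

definition smooth_real :: "(real \<Rightarrow> complex) \<Rightarrow> bool" where
  "smooth_real g \<longleftrightarrow>
     (\<exists>d :: nat \<Rightarrow> real \<Rightarrow> complex.
        d 0 = g \<and> (\<forall>n t. (d n has_vector_derivative d (Suc n) t) (at t)))"

text \<open>
  A smooth Jordan curve is given by a regular 1-periodic parametrization of class \<open>C^\<infinity>\<close> on
  the whole real line, one period of which is \<open>{0..1}\<close>. The orientation is the positive one.
\<close>

definition smooth_jordan_curve :: "(real \<Rightarrow> complex) \<Rightarrow> bool" where
  "smooth_jordan_curve \<gamma> \<longleftrightarrow>
     smooth_real \<gamma> \<and> (\<forall>t. \<gamma> (t + 1) = \<gamma> t) \<and> (\<forall>t. vector_derivative \<gamma> (at t) \<noteq> 0) \<and>
     simple_path \<gamma> \<and> (\<forall>w \<in> inside (path_image \<gamma>). winding_number \<gamma> w = 1)"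

definition toeplitz_contour :: "complex option set \<Rightarrow> complex \<Rightarrow> (real \<Rightarrow> complex) \<Rightarrow> bool" where
  "toeplitz_contour U z \<gamma> \<longleftrightarrow>
     smooth_jordan_curve \<gamma> \<and>
     path_image \<gamma> \<subseteq> finite_part U \<and>
     insert z (- finite_part U) \<subseteq> inside (path_image \<gamma>)"

text \<open>The value does not depend on the contour that is selected.\<close>

definition toeplitz ::
    "complex option set \<Rightarrow> (complex \<Rightarrow> complex) \<Rightarrow> (complex \<Rightarrow> complex) \<Rightarrow> complex \<Rightarrow> complex" where
  "toeplitz U F f = (\<lambda>z.
     let \<gamma> = (SOME \<gamma>. toeplitz_contour U z \<gamma>)
     in 1 / (2 * of_real pi * \<i>) * contour_integral \<gamma> (\<lambda>\<xi>. F \<xi> * f \<xi> / (\<xi> - z)))"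

end

theory Submission
  imports Defs "HOL-Real_Asymp.Real_Asymp"
begin

text \<open>
  The matrix of \<open>T_F\<close> with respect to the monomials is the Toeplitz matrix
  \<open>(a (i - j))\<close>, and the seminorms of \<open>H(\<complex>)\<close> are weighted \<open>l^1\<close> norms of the Taylor
  coefficients, with weight \<open>\<rho> = exp p\<close> to the power \<open>i\<close>. Since these weights are
  multiplicative, a Toeplitz matrix acts on the weighted \<open>l^1\<close> space with norm at most
  \<open>A p = (\<Sum>n. |a n| * exp (p * n))\<close>, the sum being over all integers \<open>n\<close>
  (\<open>toeplitz_norm_le\<close>). Its part over \<open>n \<ge> 1\<close> is finite for every \<open>p\<close>, because the Laurent
  series converges for all large arguments; in its part over \<open>n \<le> 0\<close> the exponentials are at
  most 1, so this part is at most \<open>\<Sum>n\<le>0. |a n|\<close> (\<open>laurent_weighted_bound\<close>).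

  If \<open>\<Sum>n\<le>0. |a n|\<close> is finite, then each \<open>A p\<close> is finite and \<open>T_F\<close> is strongly tame. An
  estimate in which the index of the seminorm is preserved iterates to
  \<open>\<parallel>T^k x\<parallel>\<^sub>p \<le> (A p)^k * \<parallel>x\<parallel>\<^sub>p\<close>, so \<open>T_F\<close> is m-topologizable. Under the hypothesis of the
  second part \<open>A p \<le> 1\<close> for all \<open>p\<close>, so \<open>T_F\<close> is a contraction for every seminorm, and so are
  its powers.

  The analytic content is the identification of the matrix (\<open>toeplitz_sums\<close>). The contour in the
  definition of \<open>T_F\<close> may be any smooth Jordan curve around \<open>z\<close> and the complement
  of the domain of \<open>F\<close>. Cauchy's theorem replaces it by an arbitrarily large circle
  (\<open>toeplitz_contour_integral_eq_circlepath\<close>), on which the Laurent expansion of the product of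
  \<open>F\<close> and \<open>f\<close> is available: its nonnegative part is reproduced by Cauchy's integral formula,
  and the contribution of the negative part vanishes as the radius tends to infinity.
\<close>

section \<open>Tame and contractive operators\<close>

locale seminormed_space =
  fixes E :: "'v::ab_group_add set" and nrm :: "nat \<Rightarrow> 'v \<Rightarrow> real"
  assumes zero: "0 \<in> E" and diff: "x \<in> E \<Longrightarrow> y \<in> E \<Longrightarrow> x - y \<in> E"
    and nrm_zero: "nrm p 0 = 0"
    and nrm_nonneg: "x \<in> E \<Longrightarrow> nrm p x \<ge> 0"
    and triangle: "x \<in> E \<Longrightarrow> y \<in> E \<Longrightarrow> nrm p (x + y) \<le> nrm p x + nrm p y"
begin

lemma topspace_seminorm: "topspace (seminorm_topology E nrm) = E"
proof -
  have "x \<in> \<Union> {{y \<in> E. nrm p (y - x) < e} | p x e. p \<ge> 1 \<and> x \<in> E \<and> e > 0}" if "x \<in> E" for x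
  proof
    show "x \<in> {y \<in> E. nrm 1 (y - x) < 1}" using that nrm_zero by simp
    show "{y \<in> E. nrm 1 (y - x) < 1} \<in> {{y \<in> E. nrm p (y - x) < e} | p x e. p \<ge> 1 \<and> x \<in> E \<and> e > 0}"
      using that zero_less_one le_refl[of "1::nat"] by blast
  qed
  then show ?thesis
    unfolding seminorm_topology_def topology_generated_by_topspace by blast
qed

lemma openin_seminorm_ball:
  assumes "p \<ge> 1" "x \<in> E" "e > 0"
  shows "openin (seminorm_topology E nrm) {y \<in> E. nrm p (y - x) < e}"
  unfolding seminorm_topology_def using assms by (intro topology_generated_by_Basis) blast

text \<open>
  It suffices to consider preimages of the seminorm balls that generate the topology. The
  estimate \<open>nrm p (T (v - u)) \<le> C * nrm p (v - u)\<close> shows that together with \<open>u\<close>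
  the preimage contains a ball around \<open>u\<close> for the same seminorm.
\<close>

lemma strongly_tame_imp_continuous:
  assumes T: "strongly_tame s E nrm T"
  shows "continuous_linear_operator_on s E nrm T"
proof -
  let ?B = "{{y \<in> E. nrm p (y - x) < e} | p x e. p \<ge> 1 \<and> x \<in> E \<and> e > 0}"
  have lin: "linear_operator_on s E T"
    using T by (simp add: strongly_tame_def)
  have TE: "T x \<in> E" if "x \<in> E" for x
    using lin that by (auto simp: linear_operator_on_def)
  have Tdiff: "T (x - y) = T x - T y" if "x \<in> E" "y \<in> E" for x y
  proof -
    have "T ((x - y) + y) = T (x - y) + T y"
      using lin diff[OF that] that unfolding linear_operator_on_def by blast
    then show ?thesis by simp
  qed
  have "openin (seminorm_topology E nrm) (T -` V \<inter> topspace (seminorm_topology E nrm))"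
    if Vin: "V \<in> ?B" for V
  proof -
    obtain p x e where V: "V = {y \<in> E. nrm p (y - x) < e}" and p: "p \<ge> 1" and x: "x \<in> E"
      using Vin by blast
    obtain C where C: "C > 0" "\<And>x. x \<in> E \<Longrightarrow> nrm p (T x) \<le> C * nrm p x"
      using T p unfolding strongly_tame_def by blast
    have "\<exists>W. openin (seminorm_topology E nrm) W \<and> u \<in> W \<and> W \<subseteq> {u \<in> E. T u \<in> V}"
      if u: "u \<in> E" "T u \<in> V" for u
    proof -
      define d where "d = (e - nrm p (T u - x)) / C"
      have "d > 0"
        using u C(1) by (simp add: d_def V)
      have "T v \<in> V" if v: "v \<in> E" "nrm p (v - u) < d" for v
      proof -
        have "nrm p (T v - x) = nrm p (T (v - u) + (T u - x))"
          using Tdiff[OF v(1) u(1)] by simp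
        also have "\<dots> \<le> nrm p (T (v - u)) + nrm p (T u - x)"
          using TE diff u v x by (intro triangle) auto
        also have "nrm p (T (v - u)) \<le> C * nrm p (v - u)"
          using C diff u v by blast
        also have "\<dots> < C * d"
          using v C(1) by simp
        also have "C * d = e - nrm p (T u - x)"
          using C(1) by (simp add: d_def)
        finally show ?thesis
          using TE v(1) by (simp add: V)
      qed
      moreover have "u \<in> {y \<in> E. nrm p (y - u) < d}"
        using u nrm_zero \<open>d > 0\<close> by simp
      ultimately show ?thesis
        using openin_seminorm_ball[OF p u(1) \<open>d > 0\<close>] by blast
    qed
    then have "openin (seminorm_topology E nrm) {u \<in> E. T u \<in> V}"
      by (subst openin_subopen) blast
    moreover have "{u \<in> E. T u \<in> V} = T -` V \<inter> topspace (seminorm_topology E nrm)"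
      using topspace_seminorm by auto
    ultimately show ?thesis by simp
  qed
  then have "continuous_map (seminorm_topology E nrm) (seminorm_topology E nrm) T"
    unfolding seminorm_topology_def[of E nrm]
  proof (intro continuous_on_generated_topo)
    show "T ` topspace (topology_generated_by ?B) \<subseteq> \<Union> ?B"
      using TE topspace_seminorm unfolding seminorm_topology_def topology_generated_by_topspace
      by blast
  qed simp
  with lin show ?thesis
    by (simp add: continuous_linear_operator_on_def)
qed

lemma iterate_bound:
  assumes "T ` E \<subseteq> E" "C \<ge> 0" "\<And>x. x \<in> E \<Longrightarrow> nrm p (T x) \<le> C * nrm p x" "x \<in> E"
  shows "(T ^^ k) x \<in> E \<and> nrm p ((T ^^ k) x) \<le> C ^ k * nrm p x"
proof (induction k)
  case (Suc k)
  have "nrm p (T ((T ^^ k) x)) \<le> C * nrm p ((T ^^ k) x)"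
    using Suc assms(3) by blast
  also have "\<dots> \<le> C * (C ^ k * nrm p x)"
    using Suc assms(2) by (intro mult_left_mono) auto
  finally show ?case
    using Suc assms(1) by (auto simp: mult.assoc)
qed (use assms in auto)

text \<open>
  A tame estimate loses nothing in the seminorm index and can therefore be iterated, which gives
  \<open>q = p\<close>. Passing to \<open>max C 1\<close> meets the requirement that the constant is at least 1.
\<close>

lemma strongly_tame_imp_m_topologizable:
  assumes T: "strongly_tame s E nrm T"
  shows "m_topologizable s E nrm T"
proof -
  have TE: "T ` E \<subseteq> E"
    using T by (auto simp: strongly_tame_def linear_operator_on_def)
  have "\<exists>q\<ge>1. \<exists>C\<ge>1. \<forall>k\<ge>1. \<forall>x\<in>E. nrm p ((T ^^ k) x) \<le> C ^ k * nrm q x" if p: "p \<ge> 1" for p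
  proof -
    obtain C where C: "C > 0" "\<And>x. x \<in> E \<Longrightarrow> nrm p (T x) \<le> C * nrm p x"
      using T p unfolding strongly_tame_def by blast
    have "nrm p (T x) \<le> max C 1 * nrm p x" if "x \<in> E" for x
      using C(2)[OF that] mult_right_mono[OF max.cobounded1 nrm_nonneg[OF that, of p]] by (rule order_trans)
    then have "\<forall>k\<ge>1. \<forall>x\<in>E. nrm p ((T ^^ k) x) \<le> max C 1 ^ k * nrm p x"
      using iterate_bound[OF TE, of "max C 1" p] C(1) by simp
    then show ?thesis
      using p by (intro exI[of _ p] exI[of _ "max C 1"] conjI) auto
  qed
  with strongly_tame_imp_continuous[OF T] show ?thesis
    unfolding m_topologizable_def by blast
qed

lemma contractive_imp_power_bounded:
  assumes lin: "linear_operator_on s E T"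
    and le: "\<And>p x. p \<ge> 1 \<Longrightarrow> x \<in> E \<Longrightarrow> nrm p (T x) \<le> nrm p x"
  shows "power_bounded s E nrm T"
proof -
  have "strongly_tame s E nrm T"
    unfolding strongly_tame_def using lin le by (auto intro!: exI[of _ "1::real"])
  moreover have "T ` E \<subseteq> E"
    using lin by (auto simp: linear_operator_on_def)
  then have "\<forall>k\<ge>1. \<forall>x\<in>E. nrm p ((T ^^ k) x) \<le> 1 * nrm p x" if "p \<ge> 1" for p
    using iterate_bound[of T 1 p] le that by simp
  ultimately show ?thesis
    unfolding power_bounded_def using strongly_tame_imp_continuous by blast
qed

end

section \<open>Replacing a contour by a large circle\<close>

text \<open>
  Cauchy's theorem for the difference of two loops, reduced to the homological form for a single
  loop by joining the two along a segment: the new loop runs through \<open>g\<close>, along the segment,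
  backwards through \<open>h\<close> and back along the segment. Its winding numbers outside \<open>S\<close> are the differences, hence 0, and the two
  passages through the segment cancel in the integral.
\<close>

lemma contour_integral_linked_loops_eq:
  assumes S: "open S" "f holomorphic_on S"
    and g: "valid_path g" "pathfinish g = pathstart g" "path_image g \<subseteq> S"
    and h: "valid_path h" "pathfinish h = pathstart h" "path_image h \<subseteq> S"
    and pq: "p \<in> path_image g" "q \<in> path_image h" "closed_segment p q \<subseteq> S"
    and wn: "\<And>w. w \<notin> S \<Longrightarrow> winding_number g w = winding_number h w"
  shows "contour_integral g f = contour_integral h f"
proof -
  obtain u v where u: "u \<in> {0..1}" "p = g u" and v: "v \<in> {0..1}" "q = h v"
    using pq unfolding path_image_def by auto
  \<comment> \<open>the loops are reparametrized to start at the ends of the segment\<close>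
  define g' where "g' = shiftpath u g"
  define h' where "h' = shiftpath v h"
  have g': "valid_path g'" "pathstart g' = p" "pathfinish g' = p" "path_image g' \<subseteq> S"
    using g u by (auto simp: g'_def pathstart_shiftpath pathfinish_shiftpath path_image_shiftpath
        intro!: valid_path_shiftpath)
  have h': "valid_path h'" "pathstart h' = q" "pathfinish h' = q" "path_image h' \<subseteq> S"
    using h v by (auto simp: h'_def pathstart_shiftpath pathfinish_shiftpath path_image_shiftpath
        intro!: valid_path_shiftpath)
  have seg: "closed_segment q p \<subseteq> S"
    using pq by (simp add: closed_segment_commute)
  define L where "L = g' +++ linepath p q +++ reversepath h' +++ linepath q p"
  have wnL: "winding_number L w = 0" if w: "w \<notin> S" for w
  proof -
    have nin: "w \<notin> path_image g'" "w \<notin> path_image h'" "w \<notin> closed_segment p q"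
      "w \<notin> closed_segment q p" "w \<notin> path_image g" "w \<notin> path_image h"
      using g' h' pq seg w g h by auto
    have "winding_number L w = winding_number g' w + (winding_number (linepath p q) w
           + (winding_number (reversepath h') w + winding_number (linepath q p) w))"
      using nin g' h' unfolding L_def
      by (simp add: winding_number_join valid_path_imp_path path_image_join)
    also have "winding_number (linepath q p) w = - winding_number (linepath p q) w"
      using winding_number_reversepath[of "linepath p q" w] nin by simp
    also have "winding_number (reversepath h') w = - winding_number h' w"
      using nin h' by (simp add: winding_number_reversepath valid_path_imp_path)
    also have "winding_number g' w = winding_number g w"
      unfolding g'_def using g u nin by (intro winding_number_shiftpath) (auto simp: valid_path_imp_path)
    also have "winding_number h' w = winding_number h w"
      unfolding h'_def using h v nin by (intro winding_number_shiftpath) (auto simp: valid_path_imp_path)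
    finally show ?thesis using wn[OF w] by simp
  qed
  have int: "f contour_integrable_on c" if "valid_path c" "path_image c \<subseteq> S" for c
    using contour_integrable_holomorphic_simple[OF S(2) S(1)] that by blast
  have "(f has_contour_integral 0) L"
    unfolding L_def
  proof (rule Cauchy_theorem_global[OF S])
    fix w assume "w \<notin> S"
    from wnL[OF this] show "winding_number (g' +++ linepath p q +++ reversepath h' +++ linepath q p) w = 0"
      by (simp add: L_def)
  qed (use g' h' pq seg in \<open>auto simp: path_image_join\<close>)
  then have "0 = contour_integral L f"
    by (simp add: contour_integral_unique)
  also have "\<dots> = contour_integral g' f + (contour_integral (linepath p q) f
           + (contour_integral (reversepath h') f + contour_integral (linepath q p) f))"
    using g' h' pq seg unfolding L_def
    by (simp add: contour_integral_join int)
  also have "contour_integral (linepath q p) f = - contour_integral (linepath p q) f"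
    using contour_integral_reversepath[of "linepath p q" f] by simp
  also have "contour_integral (reversepath h') f = - contour_integral h' f"
    using h' by (simp add: contour_integral_reversepath)
  also have "contour_integral g' f = contour_integral g f"
    unfolding g'_def using g u by (intro contour_integral_shiftpath)
  also have "contour_integral h' f = contour_integral h f"
    unfolding h'_def using h v by (intro contour_integral_shiftpath)
  finally show ?thesis by simp
qed

lemma smooth_jordan_curve_imp_valid_path:
  assumes "smooth_jordan_curve \<gamma>"
  shows "valid_path \<gamma>"
proof -
  from assms obtain d where d: "d 0 = \<gamma>" "\<And>n t. (d n has_vector_derivative d (Suc n) t) (at t)"
    unfolding smooth_jordan_curve_def smooth_real_def by blast
  have "continuous_on {0..1} (d 1)"
    by (meson d(2) continuous_at_imp_continuous_on has_vector_derivative_continuous)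
  moreover have "(\<gamma> has_vector_derivative d 1 t) (at t)" for t
    using d(2)[of 0 t] d(1) by simp
  ultimately have "\<gamma> C1_differentiable_on {0..1}"
    unfolding C1_differentiable_on_def by blast
  then show ?thesis
    unfolding valid_path_def by (rule C1_differentiable_imp_piecewise)
qed

text \<open>
  Every admissible contour can be replaced by any sufficiently large circle. The point \<open>p\<close> of
  the contour with the largest modulus serves as the point at which the circle is linked: beyond
  \<open>p\<close> the radial ray stays outside the contour, hence in the domain of \<open>\<phi>\<close>. Both
  curves wind once around every point that is missing from this domain.
\<close>

lemma toeplitz_contour_integral_eq_circlepath:
  assumes op: "open (finite_part U)" and \<phi>: "\<phi> holomorphic_on finite_part U - {z}"
    and \<gamma>: "toeplitz_contour U z \<gamma>"
  shows "\<exists>r. \<forall>R>r. contour_integral \<gamma> \<phi> = contour_integral (circlepath 0 R) \<phi>"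
proof -
  let ?S = "finite_part U - {z}"
  have jordan: "smooth_jordan_curve \<gamma>" and sub: "path_image \<gamma> \<subseteq> finite_part U"
    and ins: "insert z (- finite_part U) \<subseteq> inside (path_image \<gamma>)"
    using \<gamma> by (auto simp: toeplitz_contour_def)
  have v: "valid_path \<gamma>"
    using jordan by (rule smooth_jordan_curve_imp_valid_path)
  have loop: "pathfinish \<gamma> = pathstart \<gamma>"
  proof -
    have "\<gamma> (0 + 1) = \<gamma> 0"
      using jordan unfolding smooth_jordan_curve_def by blast
    then show ?thesis by (simp add: pathfinish_def pathstart_def)
  qed
  have cpt: "compact (path_image \<gamma>)"
    using v by (simp add: compact_valid_path_image)
  obtain p where p: "p \<in> path_image \<gamma>" "\<And>q. q \<in> path_image \<gamma> \<Longrightarrow> norm q \<le> norm p"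
    using continuous_attains_sup[OF cpt path_image_nonempty continuous_on_norm_id] by blast
  have "path_image \<gamma> \<subseteq> cball 0 (norm p)"
    using p(2) by (simp add: subset_iff)
  then have "- cball 0 (norm p) \<subseteq> outside (path_image \<gamma>)"
    by (rule outside_subset_convex[OF convex_cball])
  then have out: "w \<in> outside (path_image \<gamma>)" if "norm w > norm p" for w
    using that by (meson ComplI mem_cball_0 not_le subsetD)
  have insball: "norm w \<le> norm p" if "w \<in> inside (path_image \<gamma>)" for w
    using out[of w] that inside_Int_outside[of "path_image \<gamma>"] by (meson disjoint_iff not_le)
  have outS: "w \<in> ?S" if "norm w > norm p" for w
  proof -
    have "w \<notin> inside (path_image \<gamma>)"
      using insball[of w] that by linarith
    then show ?thesis using ins by blast
  qed
  have imS: "path_image \<gamma> \<subseteq> ?S"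
    using sub ins inside_no_overlap[of "path_image \<gamma>"] by blast
  have p0: "p \<noteq> 0"
  proof
    assume "p = 0"
    then have "path_image \<gamma> \<subseteq> {0}" using p(2) by (simp add: subset_iff)
    then have "inside (path_image \<gamma>) = {}"
      using p(1) by (metis inside_singleton subset_singletonD empty_iff)
    then show False using ins by simp
  qed
  have "contour_integral \<gamma> \<phi> = contour_integral (circlepath 0 R) \<phi>" if R: "R > norm p" for R
  proof (rule contour_integral_linked_loops_eq[where S = ?S and p = p and q = "of_real (R / norm p) * p"])
    show "open ?S" using op by (rule open_delete)
    have Rpos: "R > 0" using R norm_ge_zero[of p] by linarith
    show "path_image (circlepath 0 R) \<subseteq> ?S"
    proof
      fix w assume "w \<in> path_image (circlepath 0 R)"
      then have "norm w = R" using Rpos by simp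
      then show "w \<in> ?S" using R by (intro outS) simp
    qed
    show "of_real (R / norm p) * p \<in> path_image (circlepath 0 R)"
      using p0 Rpos by (simp add: norm_mult norm_divide)
    show "closed_segment p (of_real (R / norm p) * p) \<subseteq> ?S"
    proof
      fix w assume "w \<in> closed_segment p (of_real (R / norm p) * p)"
      then obtain u where u: "0 \<le> u" "u \<le> 1" "w = (1 - u) *\<^sub>R p + u *\<^sub>R (of_real (R / norm p) * p)"
        unfolding closed_segment_def by blast
      then have w: "w = of_real (1 + u * (R / norm p - 1)) * p"
        by (simp add: scaleR_conv_of_real algebra_simps)
      have quot: "R / norm p > 1" using R p0 by simp
      show "w \<in> ?S"
      proof (cases "u = 0")
        case True
        then show ?thesis using w p imS by auto
      next
        case False
        then have t: "1 + u * (R / norm p - 1) > 1"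
          using u quot by simp
        have "norm w = (1 + u * (R / norm p - 1)) * norm p"
          unfolding w norm_mult using t by (metis abs_of_pos norm_of_real less_trans zero_less_one)
        also have "\<dots> > 1 * norm p"
          using t p0 by (intro mult_strict_right_mono) auto
        finally show ?thesis using outS by simp
      qed
    qed
    show "winding_number \<gamma> w = winding_number (circlepath 0 R) w" if "w \<notin> ?S" for w
    proof -
      from that ins have w: "w \<in> inside (path_image \<gamma>)" by blast
      then have "winding_number \<gamma> w = 1"
        using jordan unfolding smooth_jordan_curve_def by blast
      moreover have "winding_number (circlepath 0 R) w = 1"
        using insball[OF w] R by (intro winding_number_circlepath) simp
      ultimately show ?thesis by simp
    qed
  qed (use \<phi> v loop imS p(1) in simp_all)
  then show ?thesis by blast
qed

lemma finite_part_nhd_infinity: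
  assumes "openin riemann_sphere U" "None \<in> U"
  shows "open (finite_part U)" "compact (- finite_part U)"
proof -
  obtain C :: "complex set" where C: "compact C" "U = insert None (Some ` (- C))"
    using assms by (auto simp: openin_Alexandroff_compactification Compl_eq_Diff_UNIV)
  then have "finite_part U = - C"
    by (auto simp: finite_part_def)
  then show "open (finite_part U)" "compact (- finite_part U)"
    using C by (auto simp: compact_imp_closed open_Compl)
qed

lemma inside_circlepath:
  assumes "r > 0"
  shows "inside (path_image (circlepath 0 r)) = ball 0 r"
  using inside_frontier_eq_interior[of "cball (0::complex) r"] assms by simp

lemma smooth_jordan_curve_circlepath:
  assumes "r > 0"
  shows "smooth_jordan_curve (circlepath 0 r)"
proof -
  have der: "((\<lambda>t. (2 * pi * \<i>) ^ n * circlepath 0 r t) has_vector_derivative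
              (2 * pi * \<i>) ^ Suc n * circlepath 0 r t) (at t)" for n t
    unfolding circlepath
    by (auto intro!: derivative_eq_intros has_vector_derivative_real_field simp: algebra_simps)
  have "smooth_real (circlepath 0 r)"
    unfolding smooth_real_def
    by (rule exI[of _ "\<lambda>n t. (2 * pi * \<i>) ^ n * circlepath 0 r t"]) (use der in auto)
  moreover have "circlepath 0 r (t + 1) = circlepath 0 r t" for t
    by (simp add: circlepath algebra_simps exp_add)
  moreover have "vector_derivative (circlepath 0 r) (at t) \<noteq> 0" for t
    using vector_derivative_at[OF der[of 0 t]] assms by (simp add: circlepath)
  ultimately show ?thesis
    using assms inside_circlepath[OF assms] unfolding smooth_jordan_curve_def
    by (auto simp: simple_path_circlepath intro!: winding_number_circlepath)
qed

text \<open>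
  The operator integrates over a contour selected by Hilbert choice; this lemma makes the selected
  curve an admissible one.
\<close>

lemma toeplitz_contour_exists:
  assumes "openin riemann_sphere U" "None \<in> U"
  shows "\<exists>\<gamma>. toeplitz_contour U z \<gamma>"
proof -
  have "bounded (insert z (- finite_part U))"
    using finite_part_nhd_infinity[OF assms] by (simp add: compact_imp_bounded)
  then obtain r where r: "r > 0" "insert z (- finite_part U) \<subseteq> ball 0 r"
    by (metis bounded_subset_ballD)
  have "path_image (circlepath 0 r) \<subseteq> finite_part U"
    using r by fastforce
  then have "toeplitz_contour U z (circlepath 0 r)"
    unfolding toeplitz_contour_def using r smooth_jordan_curve_circlepath inside_circlepath[OF r(1)] by auto
  then show ?thesis by blast
qed

section \<open>Convolution of coefficient sequences\<close>

lemma abs_summable_product_has_sum: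
  fixes x :: "'i \<Rightarrow> 'a::{real_normed_field,banach}" and y :: "'j \<Rightarrow> 'a"
  assumes x: "(\<lambda>i. norm (x i)) summable_on A" and y: "(\<lambda>j. norm (y j)) summable_on B"
  shows "(\<lambda>(i, j). norm (x i * y j)) summable_on A \<times> B"
    and "((\<lambda>(i, j). x i * y j) has_sum (infsum x A * infsum y B)) (A \<times> B)"
proof -
  have "(\<lambda>p. norm (case p of (i, j) \<Rightarrow> x i * y j)) summable_on A \<times> B"
    unfolding Infinite_Sum.abs_summable_on_Sigma_iff
  proof (intro conjI ballI)
    show "(\<lambda>j. norm (case (i, j) of (i, j) \<Rightarrow> x i * y j)) summable_on B" for i
      using summable_on_cmult_right[OF y, of "norm (x i)"] by (simp add: norm_mult)
    have "(\<Sum>\<^sub>\<infinity>j\<in>B. norm (y j)) \<ge> 0"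
      by (rule infsum_nonneg) simp
    then show "(\<lambda>i. norm (\<Sum>\<^sub>\<infinity>j\<in>B. norm (case (i, j) of (i, j) \<Rightarrow> x i * y j))) summable_on A"
      using summable_on_cmult_left[OF x, of "\<Sum>\<^sub>\<infinity>j\<in>B. norm (y j)"]
      by (simp add: norm_mult infsum_cmult_right')
  qed
  then show abs: "(\<lambda>(i, j). norm (x i * y j)) summable_on A \<times> B"
    by (simp add: case_prod_unfold)
  then have summ: "(\<lambda>(i, j). x i * y j) summable_on A \<times> B"
    using abs_summable_summable[of "\<lambda>(i, j). x i * y j" "A \<times> B"] by (simp add: case_prod_unfold)
  have "((\<lambda>i. x i * infsum y B) has_sum (infsum x A * infsum y B)) A"
    by (intro has_sum_cmult_left has_sum_infsum abs_summable_summable[OF x])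
  moreover have "((\<lambda>j. case (i, j) of (i, j) \<Rightarrow> x i * y j) has_sum (x i * infsum y B)) B" for i
    using has_sum_cmult_right[OF has_sum_infsum[OF abs_summable_summable[OF y]]] by simp
  ultimately show "((\<lambda>(i, j). x i * y j) has_sum (infsum x A * infsum y B)) (A \<times> B)"
    by (intro has_sum_SigmaI[where g = "\<lambda>i. x i * infsum y B"] summ)
qed

text \<open>
  The product of a two-sided and a one-sided absolutely convergent series, summed along the
  diagonals \<open>n + j = m\<close> of the double series.
\<close>

lemma has_sum_convolution:
  fixes x :: "int \<Rightarrow> 'a::{real_normed_field,banach}" and y :: "nat \<Rightarrow> 'a"
  assumes x: "(\<lambda>i. norm (x i)) summable_on UNIV" and y: "(\<lambda>j. norm (y j)) summable_on UNIV"
  shows "(\<lambda>j. norm (x (m - int j) * y j)) summable_on UNIV"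
    and "((\<lambda>m. \<Sum>\<^sub>\<infinity>j. x (m - int j) * y j) has_sum (infsum x UNIV * infsum y UNIV)) UNIV"
proof -
  have bij: "bij_betw (\<lambda>(m, j). (m - int j, j)) (UNIV \<times> UNIV) (UNIV \<times> UNIV)"
    by (rule bij_betwI[where g = "\<lambda>(n, j). (n + int j, j)"]) auto
  have abs: "(\<lambda>(m, j). norm (x (m - int j) * y j)) summable_on UNIV \<times> UNIV"
    using abs_summable_product_has_sum(1)[OF x y]
      summable_on_reindex_bij_betw[OF bij, of "\<lambda>(n, j). norm (x n * y j)"]
    by (simp add: case_prod_unfold)
  then show sumj: "(\<lambda>j. norm (x (m - int j) * y j)) summable_on UNIV" for m
    by (rule summable_on_SigmaD1) simp
  have "((\<lambda>(m, j). x (m - int j) * y j) has_sum (infsum x UNIV * infsum y UNIV)) (UNIV \<times> UNIV)"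
    using abs_summable_product_has_sum(2)[OF x y]
      has_sum_reindex_bij_betw[OF bij, of "\<lambda>(n, j). x n * y j"]
    by (simp add: case_prod_unfold)
  then show "((\<lambda>m. \<Sum>\<^sub>\<infinity>j. x (m - int j) * y j) has_sum (infsum x UNIV * infsum y UNIV)) UNIV"
    by (rule has_sum_SigmaD) (simp add: has_sum_infsum abs_summable_summable[OF sumj])
qed

text \<open>
  Row \<open>m\<close> of the Toeplitz matrix applied to \<open>c\<close>. The row index is an arbitrary
  integer, since the coefficients with negative index are those of the principal part that the
  operator cuts off.
\<close>

definition toeplitz_coeff :: "(int \<Rightarrow> complex) \<Rightarrow> (nat \<Rightarrow> complex) \<Rightarrow> int \<Rightarrow> complex" where
  "toeplitz_coeff a c m = (\<Sum>\<^sub>\<infinity>j. a (m - int j) * c j)"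

lemma weighted_shift:
  fixes w :: "'a::field"
  assumes "w \<noteq> 0"
  shows "u * w powi (m - int j) * (v * w ^ j) = u * v * w powi m"
  using assms by (simp add: power_int_diff field_simps)

text \<open>
  Young's inequality for the convolution in weighted \<open>l^1\<close> spaces: the weight \<open>\<rho>\<close>
  to the power \<open>m\<close> is multiplicative, so \<open>\<rho>\<close> can be absorbed into both factors
  and the double series of absolute values sums to the product.
\<close>

lemma
  fixes a :: "int \<Rightarrow> complex" and c :: "nat \<Rightarrow> complex" and \<rho> :: real
  assumes \<rho>: "\<rho> > 0"
    and a: "(\<lambda>n. norm (a n) * \<rho> powi n) summable_on UNIV"
    and c: "(\<lambda>j. norm (c j) * \<rho> ^ j) summable_on UNIV"
  shows toeplitz_row_abs_summable: "(\<lambda>j. norm (a (m - int j) * c j)) summable_on UNIV"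
    and toeplitz_coeff_summable: "(\<lambda>m. norm (toeplitz_coeff a c m) * \<rho> powi m) summable_on UNIV"
    and toeplitz_coeff_bound: "(\<Sum>\<^sub>\<infinity>m. norm (toeplitz_coeff a c m) * \<rho> powi m)
           \<le> (\<Sum>\<^sub>\<infinity>n. norm (a n) * \<rho> powi n) * (\<Sum>\<^sub>\<infinity>j. norm (c j) * \<rho> ^ j)"
proof -
  define x where "x = (\<lambda>n. norm (a n) * \<rho> powi n)"
  define y where "y = (\<lambda>j. norm (c j) * \<rho> ^ j)"
  have x: "(\<lambda>i. norm (x i)) summable_on UNIV" and y: "(\<lambda>j. norm (y j)) summable_on UNIV"
    using a c \<rho> by (auto simp: x_def y_def)
  have xy: "x (m - int j) * y j = norm (a (m - int j) * c j) * \<rho> powi m" for m j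
    unfolding x_def y_def norm_mult using \<rho> by (intro weighted_shift) simp
  have row: "(\<lambda>j. norm (a (m - int j) * c j)) summable_on UNIV" for m
    using has_sum_convolution(1)[OF x y, of m] \<rho> unfolding xy
    by (simp add: abs_mult summable_on_cmult_left')
  then show "(\<lambda>j. norm (a (m - int j) * c j)) summable_on UNIV" .
  have conv: "((\<lambda>m. (\<Sum>\<^sub>\<infinity>j. norm (a (m - int j) * c j)) * \<rho> powi m) has_sum
      (infsum x UNIV * infsum y UNIV)) UNIV"
    using has_sum_convolution(2)[OF x y] unfolding xy infsum_cmult_left' .
  have le: "norm (toeplitz_coeff a c m) * \<rho> powi m \<le> (\<Sum>\<^sub>\<infinity>j. norm (a (m - int j) * c j)) * \<rho> powi m" for m
    unfolding toeplitz_coeff_def using \<rho> by (intro mult_right_mono norm_infsum_bound row) auto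
  show S: "(\<lambda>m. norm (toeplitz_coeff a c m) * \<rho> powi m) summable_on UNIV"
    using summable_on_comparison_test[OF has_sum_imp_summable[OF conv] le] \<rho> by simp
  have "(\<Sum>\<^sub>\<infinity>m. norm (toeplitz_coeff a c m) * \<rho> powi m) \<le> infsum x UNIV * infsum y UNIV"
    using has_sum_mono[OF has_sum_infsum[OF S] conv le] .
  then show "(\<Sum>\<^sub>\<infinity>m. norm (toeplitz_coeff a c m) * \<rho> powi m)
           \<le> (\<Sum>\<^sub>\<infinity>n. norm (a n) * \<rho> powi n) * (\<Sum>\<^sub>\<infinity>j. norm (c j) * \<rho> ^ j)"
    by (simp add: x_def y_def)
qed

lemma has_sum_toeplitz_coeff:
  fixes w :: complex
  assumes w: "w \<noteq> 0" and a: "((\<lambda>n. a n * w powi n) has_sum s) UNIV"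
    and c: "((\<lambda>j. c j * w ^ j) has_sum t) UNIV"
  shows "((\<lambda>m. toeplitz_coeff a c m * w powi m) has_sum (s * t)) UNIV"
proof -
  have "((\<lambda>m. \<Sum>\<^sub>\<infinity>j. a (m - int j) * w powi (m - int j) * (c j * w ^ j)) has_sum
         (infsum (\<lambda>n. a n * w powi n) UNIV * infsum (\<lambda>j. c j * w ^ j) UNIV)) UNIV"
    using has_sum_convolution(2)[of "\<lambda>n. a n * w powi n" "\<lambda>j. c j * w ^ j"] a c
    by (simp add: has_sum_imp_summable summable_on_iff_abs_summable_on_complex[symmetric])
  then show ?thesis
    unfolding weighted_shift[OF w] infsum_cmult_left' toeplitz_coeff_def
    by (simp add: infsumI[OF a] infsumI[OF c])
qed

section \<open>Entire functions and their Taylor coefficients\<close>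

lemma taylor_coeff_eqI:
  assumes "\<And>z. (\<lambda>n. b n * z ^ n) sums g z"
  shows "g \<in> entire" "taylor_coeff g n = b n"
proof -
  have "g holomorphic_on ball 0 r" for r
    by (rule power_series_holomorphic) (use assms in auto)
  then have "g field_differentiable at z" for z
    by (rule holomorphic_on_imp_differentiable_at[where s = "ball 0 (norm z + 1)"]) auto
  then show "g \<in> entire"
    by (simp add: entire_def holomorphic_on_def field_differentiable_at_within)
  have "g has_fps_expansion Abs_fps b"
    by (rule has_fps_expansionI) (use assms in auto)
  from fps_nth_fps_expansion[OF this, of n] show "taylor_coeff g n = b n"
    by (simp add: taylor_coeff_def)
qed

lemma entire_taylor_sums:
  assumes "f \<in> entire"
  shows "(\<lambda>n. taylor_coeff f n * z ^ n) sums f z"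
proof -
  have "f holomorphic_on ball 0 (norm z + 1)"
    using assms by (auto simp: entire_def intro: holomorphic_on_subset)
  from holomorphic_power_series[OF this, of z] show ?thesis
    by (simp add: taylor_coeff_def)
qed

lemma powser_norm_summable_everywhere:
  fixes b :: "nat \<Rightarrow> complex"
  assumes "\<And>z. summable (\<lambda>n. b n * z ^ n)" "\<rho> \<ge> 0"
  shows "summable (\<lambda>n. norm (b n) * \<rho> ^ n)"
  using powser_insidea[OF assms(1), of "of_real \<rho>" "of_real (\<rho> + 1)"] assms(2)
  by (simp add: norm_mult norm_power)

lemma entire_taylor_abs_summable:
  assumes "f \<in> entire" "\<rho> \<ge> 0"
  shows "(\<lambda>j. norm (taylor_coeff f j) * \<rho> ^ j) summable_on UNIV"
  using powser_norm_summable_everywhere[OF sums_summable[OF entire_taylor_sums]] assms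
  by (intro summable_nonneg_imp_summable_on) auto

lemma entire_taylor_has_sum:
  assumes "f \<in> entire"
  shows "((\<lambda>j. taylor_coeff f j * z ^ j) has_sum f z) UNIV"
  using summable_on_imp_summable[OF entire_taylor_abs_summable[OF assms norm_ge_zero[of z]]]
  by (intro norm_summable_imp_has_sum entire_taylor_sums assms) (simp add: norm_mult norm_power)

lemma entire_diff: "f \<in> entire \<Longrightarrow> g \<in> entire \<Longrightarrow> f - g \<in> entire"
  unfolding entire_def fun_diff_def by (auto intro: holomorphic_intros)

lemma entire_add: "f \<in> entire \<Longrightarrow> g \<in> entire \<Longrightarrow> f + g \<in> entire"
  unfolding entire_def plus_fun_def by (auto intro: holomorphic_intros)

lemma taylor_coeff_add:
  assumes "f \<in> entire" "g \<in> entire"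
  shows "taylor_coeff (f + g) n = taylor_coeff f n + taylor_coeff g n"
proof (rule taylor_coeff_eqI(2))
  show "(\<lambda>n. (taylor_coeff f n + taylor_coeff g n) * z ^ n) sums (f + g) z" for z
    using sums_add[OF entire_taylor_sums[OF assms(1)] entire_taylor_sums[OF assms(2)]]
    by (simp add: algebra_simps)
qed

lemma taylor_coeff_scale:
  assumes "f \<in> entire"
  shows "taylor_coeff (scale_fun c f) n = c * taylor_coeff f n"
proof (rule taylor_coeff_eqI(2))
  show "(\<lambda>n. (c * taylor_coeff f n) * z ^ n) sums scale_fun c f z" for z
    using sums_mult[OF entire_taylor_sums[OF assms], of c]
    by (simp add: scale_fun_def mult.assoc)
qed

lemma entire_scale: "f \<in> entire \<Longrightarrow> scale_fun c f \<in> entire"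
  unfolding entire_def scale_fun_def by (auto intro: holomorphic_intros)

lemma entire_norm_eq:
  assumes "f \<in> entire"
  shows "entire_norm p f = exp p * (\<Sum>\<^sub>\<infinity>n. norm (taylor_coeff f n) * exp p ^ n)"
proof -
  have "(\<lambda>n. norm (taylor_coeff f n) * exp p ^ n) sums (\<Sum>\<^sub>\<infinity>n. norm (taylor_coeff f n) * exp p ^ n)"
    by (intro has_sum_imp_sums has_sum_infsum entire_taylor_abs_summable assms) simp
  from sums_mult[OF this, of "exp p"] show ?thesis
    unfolding entire_norm_def
    by (simp add: sums_iff exp_of_nat_mult[symmetric] exp_add algebra_simps)
qed

lemma entire_norm_nonneg: "f \<in> entire \<Longrightarrow> entire_norm p f \<ge> 0"
  by (simp add: entire_norm_eq infsum_nonneg)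

lemma entire_seminormed_space: "seminormed_space entire entire_norm"
proof
  \<comment> \<open>the zero function is the power series with zero coefficients\<close>
  have z: "(\<lambda>n. 0 * z ^ n) sums (0 :: complex \<Rightarrow> complex) z" for z
    by simp
  show zero: "0 \<in> entire"
    using taylor_coeff_eqI(1)[OF z] .
  have "taylor_coeff 0 n = 0" for n
    by (rule taylor_coeff_eqI(2)) (use z in simp)
  then show "entire_norm p 0 = 0" for p
    unfolding entire_norm_def by simp
  show "entire_norm p (f + g) \<le> entire_norm p f + entire_norm p g" if "f \<in> entire" "g \<in> entire" for p f g
  proof -
    have "(\<Sum>\<^sub>\<infinity>n. norm (taylor_coeff (f + g) n) * exp p ^ n)
      \<le> (\<Sum>\<^sub>\<infinity>n. norm (taylor_coeff f n) * exp p ^ n + norm (taylor_coeff g n) * exp p ^ n)"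
      unfolding taylor_coeff_add[OF that] distrib_right[symmetric]
    proof (intro infsum_mono mult_right_mono norm_triangle_ineq)
      show "(\<lambda>n. norm (taylor_coeff f n + taylor_coeff g n) * exp p ^ n) summable_on UNIV"
        using entire_taylor_abs_summable[OF entire_add[OF that], of "exp p"]
        by (simp add: taylor_coeff_add[OF that])
      show "(\<lambda>n. (norm (taylor_coeff f n) + norm (taylor_coeff g n)) * exp p ^ n) summable_on UNIV"
        unfolding distrib_right using that by (intro summable_on_add entire_taylor_abs_summable) auto
    qed simp
    also have "\<dots> = (\<Sum>\<^sub>\<infinity>n. norm (taylor_coeff f n) * exp p ^ n) + (\<Sum>\<^sub>\<infinity>n. norm (taylor_coeff g n) * exp p ^ n)"
      using that by (intro infsum_add entire_taylor_abs_summable) auto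
    finally show ?thesis
      using that by (simp add: entire_norm_eq entire_add distrib_left[symmetric])
  qed
qed (auto intro: entire_diff entire_norm_nonneg)

section \<open>The Toeplitz matrix of the operator\<close>

lemma laurent_at_infinity_radius:
  assumes "laurent_at_infinity F a"
  obtains r where "r \<ge> 1"
    and "\<And>w. norm w \<ge> r \<Longrightarrow> ((\<lambda>n. a n * w powi n) has_sum F w) UNIV"
    and "\<And>\<rho>. \<rho> \<ge> r \<Longrightarrow> (\<lambda>n. norm (a n) * \<rho> powi n) summable_on UNIV"
proof -
  obtain r1 where r1: "\<And>w. norm w \<ge> r1 \<Longrightarrow> ((\<lambda>n. a n * w powi n) has_sum F w) UNIV"
    using assms unfolding laurent_at_infinity_def eventually_at_infinity by blast
  show ?thesis
  proof (rule that[of "max r1 1"])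
    fix \<rho> :: real assume \<rho>: "\<rho> \<ge> max r1 1"
    have "((\<lambda>n. a n * of_real \<rho> powi n) has_sum F (of_real \<rho>)) UNIV"
      by (rule r1) (use \<rho> in simp)
    then have "(\<lambda>n. norm (a n * of_real \<rho> powi n)) summable_on UNIV"
      by (simp add: summable_on_iff_abs_summable_on_complex[symmetric] has_sum_imp_summable)
    then show "(\<lambda>n. norm (a n) * \<rho> powi n) summable_on UNIV"
      using \<rho> by (simp add: norm_mult norm_power_int)
  qed (use r1 in auto)
qed

text \<open>
  The nonnegative part of a Laurent series approximates it at infinity up to \<open>O(1/|w|)\<close>, because
  \<open>|w| powi m \<le> (r/|w|) * r powi m\<close> for \<open>m < 0\<close> and \<open>|w| \<ge> r\<close>.
\<close>

lemma laurent_minus_power_series_bound: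
  fixes b :: "int \<Rightarrow> complex"
  assumes r: "r > 0" and b: "(\<lambda>m. norm (b m) * r powi m) summable_on UNIV"
  shows "\<exists>M\<ge>0. \<forall>w s. norm w \<ge> r \<longrightarrow> ((\<lambda>m. b m * w powi m) has_sum s) UNIV \<longrightarrow>
           summable (\<lambda>i. b (int i) * w ^ i) \<and> norm (s - (\<Sum>i. b (int i) * w ^ i)) \<le> M / norm w"
proof -
  define M where "M = r * (\<Sum>\<^sub>\<infinity>m\<in>{..<0}. norm (b m) * r powi m)"
  have M: "M \<ge> 0"
    unfolding M_def using r by (intro mult_nonneg_nonneg infsum_nonneg) auto
  have "summable (\<lambda>i. b (int i) * w ^ i) \<and> norm (s - (\<Sum>i. b (int i) * w ^ i)) \<le> M / norm w"
    if w: "norm w \<ge> r" and s: "((\<lambda>m. b m * w powi m) has_sum s) UNIV" for w s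
  proof -
    let ?g = "\<lambda>m. b m * w powi m"
    have pos: "norm w > 0" using w r by linarith
    have sub: "?g summable_on X" for X
      using s by (meson has_sum_imp_summable subset_UNIV summable_on_subset_banach)
    have "(?g has_sum infsum ?g (range int)) (range int)"
      using sub by (rule has_sum_infsum)
    then have "((\<lambda>i. b (int i) * w ^ i) has_sum infsum ?g (range int)) UNIV"
      by (subst (asm) has_sum_reindex) (auto simp: o_def inj_on_def)
    then have P: "(\<lambda>i. b (int i) * w ^ i) sums infsum ?g (range int)"
      by (rule has_sum_imp_sums)
    have univ: "UNIV = range int \<union> {..<0::int}"
    proof -
      have "x \<in> range int \<union> {..<0}" for x :: int
        by (cases "x < 0") (auto intro: range_eqI[of _ _ "nat x"])
      then show ?thesis by blast
    qed
    have "s = infsum ?g UNIV"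
      using s by (simp add: infsumI)
    also have "\<dots> = infsum ?g (range int) + infsum ?g {..<0}"
      unfolding univ by (intro infsum_Un_disjoint sub) auto
    finally have diff: "s - (\<Sum>i. b (int i) * w ^ i) = infsum ?g {..<0}"
      using sums_unique[OF P] by simp
    have "norm (infsum ?g {..<0}) \<le> (\<Sum>\<^sub>\<infinity>m\<in>{..<0}. r / norm w * (norm (b m) * r powi m))"
    proof (rule norm_infsum_le[OF has_sum_infsum[OF sub] has_sum_infsum])
      show "(\<lambda>m. r / norm w * (norm (b m) * r powi m)) summable_on {..<0}"
        using b by (intro summable_on_cmult_right) (rule summable_on_subset_banach, auto)
      fix m :: int assume "m \<in> {..<0}"
      then have m: "m = - 1 - int (nat (- 1 - m))" by simp
      define k where "k = nat (- 1 - m)"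
      have k: "m = - 1 - int k" using m by (simp only: k_def)
      have powi: "x powi m = inverse (x ^ Suc k)" if "x > 0" for x :: real
        unfolding k using that by (simp add: power_int_diff power_int_minus field_simps)
      have "norm w powi m = inverse (norm w) ^ Suc k"
        using pos by (simp add: powi power_inverse)
      also have "\<dots> \<le> inverse (norm w) * inverse r ^ k"
        using w r by (simp add: mult_left_mono power_mono le_imp_inverse_le)
      also have "\<dots> = r / norm w * r powi m"
        using r pos by (simp add: powi field_simps)
      finally have "norm (b m) * norm w powi m \<le> norm (b m) * (r / norm w * r powi m)"
        by (rule mult_left_mono) simp
      then show "norm (b m * w powi m) \<le> r / norm w * (norm (b m) * r powi m)"
        by (simp add: norm_mult norm_power_int mult_ac)
    qed
    also have "\<dots> = M / norm w"
      unfolding M_def infsum_cmult_right' by simp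
    finally show ?thesis
      using P diff by (simp add: sums_iff)
  qed
  with M show ?thesis by blast
qed

text \<open>
  The matrix of \<open>T_F\<close> is the Toeplitz matrix \<open>(a (i - j))\<close>. For large \<open>|\<xi>|\<close>, the
  product \<open>F \<xi> * f \<xi>\<close> is the Laurent series with coefficients
  \<open>b m = toeplitz_coeff a (taylor_coeff f) m\<close>. Its nonnegative part is an entire
  function \<open>P\<close>, whose Cauchy integral over a large circle is \<open>P z\<close>. The rest is
  \<open>O(1/|\<xi>|)\<close>, so that its Cauchy integral over the circle of radius \<open>R\<close> is
  \<open>O(1/R)\<close>; but the whole integral is the same for all large \<open>R\<close>, so the limit
  \<open>R \<rightarrow> \<infinity>\<close> gives \<open>T_F f z = P z\<close> without interchanging sums and integrals.
\<close>

lemma toeplitz_sums: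
  assumes U: "openin riemann_sphere U" "None \<in> U" and F: "F holomorphic_on finite_part U"
    and a: "laurent_at_infinity F a" and f: "f \<in> entire"
  shows "(\<lambda>i. toeplitz_coeff a (taylor_coeff f) (int i) * z ^ i) sums toeplitz U F f z"
proof -
  define b where "b = toeplitz_coeff a (taylor_coeff f)"
  obtain r where "r \<ge> 1"
    and Fsum: "\<And>w. norm w \<ge> r \<Longrightarrow> ((\<lambda>n. a n * w powi n) has_sum F w) UNIV"
    using laurent_at_infinity_radius[OF a] by metis
  then have r: "r > 0" by simp
  have hs: "((\<lambda>m. b m * w powi m) has_sum (F w * f w)) UNIV" if "norm w \<ge> r" for w
    unfolding b_def using that Fsum f r
    by (intro has_sum_toeplitz_coeff entire_taylor_has_sum) auto
  have "(\<lambda>m. norm (b m * of_real r powi m)) summable_on UNIV"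
    using hs[of "of_real r"] r
    by (simp add: summable_on_iff_abs_summable_on_complex[symmetric] has_sum_imp_summable)
  then have "(\<lambda>m. norm (b m) * r powi m) summable_on UNIV"
    using r by (simp add: norm_mult norm_power_int)
  from laurent_minus_power_series_bound[OF r this] obtain M where M: "M \<ge> 0"
    and tail0: "\<And>w s. norm w \<ge> r \<Longrightarrow> ((\<lambda>m. b m * w powi m) has_sum s) UNIV \<Longrightarrow>
      summable (\<lambda>i. b (int i) * w ^ i) \<and> norm (s - (\<Sum>i. b (int i) * w ^ i)) \<le> M / norm w"
    by blast
  have tail: "summable (\<lambda>i. b (int i) * w ^ i)"
      "norm (F w * f w - (\<Sum>i. b (int i) * w ^ i)) \<le> M / norm w" if "norm w \<ge> r" for w
    using tail0[OF that hs[OF that]] by auto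
  \<comment> \<open>a power series that converges for all large arguments converges everywhere\<close>
  define P where "P w = (\<Sum>i. b (int i) * w ^ i)" for w
  have P: "(\<lambda>i. b (int i) * w ^ i) sums P w" for w
  proof -
    have "summable (\<lambda>i. b (int i) * of_real (r + norm w) ^ i)"
      using tail(1)[of "of_real (r + norm w)"] r by (simp del: of_real_add)
    moreover have "norm w < norm (of_real (r + norm w) :: complex)"
      using r by (simp del: of_real_add)
    ultimately show ?thesis
      unfolding P_def by (rule summable_sums[OF powser_inside])
  qed
  have "P \<in> entire"
    using taylor_coeff_eqI(1)[of "\<lambda>i. b (int i)" P] P by blast
  then have holP: "P holomorphic_on X" for X
    by (auto simp: entire_def intro: holomorphic_on_subset)
  have holf: "f holomorphic_on X" for X
    using f by (auto simp: entire_def intro: holomorphic_on_subset)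
  define \<gamma> where "\<gamma> = (SOME \<gamma>. toeplitz_contour U z \<gamma>)"
  have \<gamma>: "toeplitz_contour U z \<gamma>"
    unfolding \<gamma>_def using toeplitz_contour_exists[OF U] by (rule someI_ex)
  define \<phi> where "\<phi> = (\<lambda>\<xi>. F \<xi> * f \<xi> / (\<xi> - z))"
  have hol\<phi>: "\<phi> holomorphic_on finite_part U - {z}"
    unfolding \<phi>_def
    by (intro holomorphic_intros holf holomorphic_on_subset[OF F]) auto
  note opn = finite_part_nhd_infinity[OF U]
  from toeplitz_contour_integral_eq_circlepath[OF opn(1) hol\<phi> \<gamma>] obtain r2 where
    r2: "\<And>R. R > r2 \<Longrightarrow> contour_integral \<gamma> \<phi> = contour_integral (circlepath 0 R) \<phi>"
    by blast
  have "bounded (- finite_part U)"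
    using opn(2) by (rule compact_imp_bounded)
  then obtain r3 where r3: "- finite_part U \<subseteq> ball 0 r3"
    by (metis bounded_subset_ballD)
  \<comment> \<open>beyond \<open>r3\<close> the circle lies in the domain of \<open>F\<close>, beyond \<open>r2\<close> it replaces the contour, beyond \<open>r\<close> the Laurent series converges\<close>
  define I where "I = contour_integral \<gamma> \<phi>"
  have bound: "norm (I - 2 * of_real pi * \<i> * P z) \<le> 2 * pi * M / (R - norm z)"
    if R: "R > Max {r, r2, r3, norm z}" for R
  proof -
    have R': "R > 0" "R > r2" "R > r" "R > norm z" "R > r3"
      using R r by auto
    have "path_image (circlepath 0 R) \<subseteq> finite_part U - {z}"
      using R' r3 by (auto simp: subset_iff)
    then have "\<phi> contour_integrable_on circlepath 0 R"
      using contour_integrable_holomorphic_simple[OF hol\<phi> open_delete[OF opn(1)]] by simp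
    then have 1: "(\<phi> has_contour_integral I) (circlepath 0 R)"
      using r2[OF R'(2)] by (simp add: I_def has_contour_integral_integral)
    have 2: "((\<lambda>\<xi>. P \<xi> / (\<xi> - z)) has_contour_integral 2 * of_real pi * \<i> * P z) (circlepath 0 R)"
      using R' by (intro Cauchy_integral_circlepath holomorphic_on_imp_continuous_on holP) auto
    have "norm (I - 2 * of_real pi * \<i> * P z) \<le> M / R / (R - norm z) * (2 * pi * R)"
    proof (rule has_contour_integral_bound_circlepath[OF has_contour_integral_diff[OF 1 2]])
      fix x :: complex assume "norm (x - 0) = R"
      then have x: "norm x = R" by simp
      have "\<phi> x - P x / (x - z) = (F x * f x - P x) / (x - z)"
        by (simp add: \<phi>_def diff_divide_distrib)
      also have "norm \<dots> = norm (F x * f x - P x) / norm (x - z)"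
        by (rule norm_divide)
      also have "\<dots> \<le> M / R / (R - norm z)"
      proof (rule frac_le)
        show "norm (F x * f x - P x) \<le> M / R"
          using tail(2)[of x] x R' by (simp add: P_def)
        show "R - norm z \<le> norm (x - z)"
          using norm_triangle_ineq2[of x z] x by simp
      qed (use R' M in auto)
      finally show "norm (\<phi> x - P x / (x - z)) \<le> M / R / (R - norm z)" .
    qed (use R' M in auto)
    also have "M / R / (R - norm z) * (2 * pi * R) = 2 * pi * M / (R - norm z)"
      using R' by simp
    finally show ?thesis .
  qed
  have "((\<lambda>R. 2 * pi * M / (R - norm z)) \<longlongrightarrow> 0) at_top"
    by real_asymp
  moreover have "eventually (\<lambda>R. norm (I - 2 * of_real pi * \<i> * P z) \<le> 2 * pi * M / (R - norm z)) at_top"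
    using eventually_gt_at_top[of "Max {r, r2, r3, norm z}"] by eventually_elim (rule bound)
  ultimately have "norm (I - 2 * of_real pi * \<i> * P z) \<le> 0"
    by (intro tendsto_lowerbound) auto
  then have "toeplitz U F f z = P z"
    by (simp add: toeplitz_def Let_def \<gamma>_def[symmetric] \<phi>_def[symmetric] I_def)
  with P[of z] show ?thesis
    by (simp add: b_def)
qed

text \<open>
  Linearity is read off from the matrix: the coefficients are additive and homogeneous in
  \<open>f\<close>, since every row converges absolutely.
\<close>

lemma toeplitz_linear_operator:
  assumes U: "openin riemann_sphere U" "None \<in> U" and F: "F holomorphic_on finite_part U"
    and a: "laurent_at_infinity F a"
  shows "linear_operator_on scale_fun entire (toeplitz U F)"
proof -
  note sums = toeplitz_sums[OF U F a]
  obtain r where r: "r \<ge> 1" "\<And>\<rho>. \<rho> \<ge> r \<Longrightarrow> (\<lambda>n. norm (a n) * \<rho> powi n) summable_on UNIV"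
    using laurent_at_infinity_radius[OF a] by metis
  have row: "(\<lambda>j. a (m - int j) * taylor_coeff f j) summable_on UNIV" if "f \<in> entire" for f m
    using abs_summable_summable[OF toeplitz_row_abs_summable[OF _ r(2) entire_taylor_abs_summable[OF that]], of r]
      r(1)
    by simp
  show ?thesis
    unfolding linear_operator_on_def
  proof (intro conjI ballI allI)
    show "toeplitz U F ` entire \<subseteq> entire"
      using taylor_coeff_eqI(1)[OF sums] by blast
    show "toeplitz U F (f + g) = toeplitz U F f + toeplitz U F g" if "f \<in> entire" "g \<in> entire" for f g
    proof
      fix z
      have "toeplitz_coeff a (taylor_coeff (f + g)) m
          = toeplitz_coeff a (taylor_coeff f) m + toeplitz_coeff a (taylor_coeff g) m" for m
        unfolding toeplitz_coeff_def taylor_coeff_add[OF that] distrib_left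
        by (intro infsum_add row that)
      then have "(\<lambda>i. toeplitz_coeff a (taylor_coeff (f + g)) (int i) * z ^ i)
          sums (toeplitz U F f z + toeplitz U F g z)"
        using sums_add[OF sums[OF that(1)] sums[OF that(2)]] by (simp add: distrib_right)
      from sums_unique2[OF sums[OF entire_add[OF that]] this]
      show "toeplitz U F (f + g) z = (toeplitz U F f + toeplitz U F g) z" by simp
    qed
    show "toeplitz U F (scale_fun c f) = scale_fun c (toeplitz U F f)" if "f \<in> entire" for c f
    proof
      fix z
      have "toeplitz_coeff a (taylor_coeff (scale_fun c f)) m = c * toeplitz_coeff a (taylor_coeff f) m" for m
        unfolding toeplitz_coeff_def taylor_coeff_scale[OF that] mult.left_commute[of _ c]
        by (rule infsum_cmult_right')
      then have "(\<lambda>i. toeplitz_coeff a (taylor_coeff (scale_fun c f)) (int i) * z ^ i)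
          sums (c * toeplitz U F f z)"
        using sums_mult[OF sums[OF that], of c] by (simp add: mult.assoc)
      from sums_unique2[OF sums[OF entire_scale[OF that]] this]
      show "toeplitz U F (scale_fun c f) z = scale_fun c (toeplitz U F f) z"
        by (simp add: scale_fun_def)
    qed
  qed
qed

text \<open>
  The seminorm \<open>entire_norm p\<close> is \<open>exp p\<close> times the weighted \<open>l^1\<close> norm of the
  Taylor coefficients with weight \<open>exp p\<close>. Discarding the coefficients with negative index only
  decreases the norm of the convolution.
\<close>

lemma toeplitz_norm_le:
  assumes U: "openin riemann_sphere U" "None \<in> U" and F: "F holomorphic_on finite_part U"
    and a: "laurent_at_infinity F a" and f: "f \<in> entire"
    and A: "(\<lambda>n. norm (a n) * exp (real p) powi n) summable_on UNIV"
  shows "entire_norm p (toeplitz U F f) \<le> (\<Sum>\<^sub>\<infinity>n. norm (a n) * exp (real p) powi n) * entire_norm p f"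
proof -
  let ?b = "toeplitz_coeff a (taylor_coeff f)" and ?e = "exp (real p)"
  note sums = toeplitz_sums[OF U F a f]
  have c: "(\<lambda>j. norm (taylor_coeff f j) * ?e ^ j) summable_on UNIV"
    by (intro entire_taylor_abs_summable f) simp
  have b: "(\<lambda>m. norm (?b m) * ?e powi m) summable_on UNIV"
    by (intro toeplitz_coeff_summable A c) simp
  have "(\<Sum>\<^sub>\<infinity>i. norm (taylor_coeff (toeplitz U F f) i) * ?e ^ i)
      = (\<Sum>\<^sub>\<infinity>m\<in>range int. norm (?b m) * ?e powi m)"
    using taylor_coeff_eqI(2)[OF sums] by (subst infsum_reindex) (auto simp: o_def inj_on_def)
  also have "\<dots> \<le> (\<Sum>\<^sub>\<infinity>m. norm (?b m) * ?e powi m)"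
    by (intro infsum_mono2 b summable_on_subset_banach[OF b]) auto
  also have "\<dots> \<le> (\<Sum>\<^sub>\<infinity>n. norm (a n) * ?e powi n) * (\<Sum>\<^sub>\<infinity>j. norm (taylor_coeff f j) * ?e ^ j)"
    by (intro toeplitz_coeff_bound A c) simp
  finally show ?thesis
    using taylor_coeff_eqI(1)[OF sums] f by (simp add: entire_norm_eq)
qed

section \<open>Weighted sums of the Laurent coefficients\<close>

lemma
  fixes f :: "'i \<Rightarrow> real"
  assumes nonneg: "\<And>i. i \<in> A \<Longrightarrow> f i \<ge> 0" and fin: "(\<Sum>\<^sub>\<infinity>i\<in>A. ennreal (f i)) < \<infinity>"
  shows summable_on_of_ennreal_infsum: "f summable_on A"
    and ennreal_infsum: "ennreal (infsum f A) = (\<Sum>\<^sub>\<infinity>i\<in>A. ennreal (f i))"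
proof -
  have eq: "(\<Sum>\<^sub>\<infinity>i\<in>A. ennreal (f i)) = (SUP F\<in>{F. finite F \<and> F \<subseteq> A}. ennreal (sum f F))"
    using nonneg by (subst nonneg_infsum_complete) (auto intro!: SUP_cong simp: sum_ennreal subset_iff)
  obtain B where B: "(\<Sum>\<^sub>\<infinity>i\<in>A. ennreal (f i)) = ennreal B" "B \<ge> 0"
    using fin by (cases "\<Sum>\<^sub>\<infinity>i\<in>A. ennreal (f i)") auto
  have "sum f F \<le> B" if "finite F" "F \<subseteq> A" for F
  proof -
    have "ennreal (sum f F) \<le> ennreal B"
      unfolding B(1)[symmetric] eq using that by (intro SUP_upper) auto
    then show ?thesis using B(2) by simp
  qed
  then show S: "f summable_on A"
    using nonneg by (intro nonneg_bdd_above_summable_on) (auto intro!: bdd_aboveI2)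
  show "ennreal (infsum f A) = (\<Sum>\<^sub>\<infinity>i\<in>A. ennreal (f i))"
    unfolding eq by (rule infsum_nonneg_is_SUPREMUM_ennreal[OF S nonneg])
qed

text \<open>
  Convergence near infinity only provides large weights, but on positive indices smaller weights
  give smaller terms.
\<close>

lemma laurent_at_infinity_weighted_summable:
  assumes a: "laurent_at_infinity F a" and \<rho>: "\<rho> > 0"
  shows "(\<lambda>n. norm (a n) * \<rho> powi n) summable_on {0<..}"
proof -
  obtain r0 where r0: "\<And>\<rho>. \<rho> \<ge> r0 \<Longrightarrow> (\<lambda>n. norm (a n) * \<rho> powi n) summable_on UNIV"
    using laurent_at_infinity_radius[OF a] by metis
  define r where "r = max r0 \<rho>"
  have "(\<lambda>n. norm (a n) * r powi n) summable_on {0<..}"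
    by (rule summable_on_subset_banach[OF r0]) (auto simp: r_def)
  then show ?thesis
  proof (rule summable_on_comparison_test)
    fix n :: int assume "n \<in> {0<..}"
    then show "norm (a n) * \<rho> powi n \<le> norm (a n) * r powi n"
      using \<rho> by (intro mult_left_mono power_int_mono) (auto simp: r_def)
  qed (use \<rho> in simp)
qed

lemma infsum_nonpos_int:
  fixes g :: "int \<Rightarrow> 'a::{comm_monoid_add,t2_space}"
  shows "g summable_on {..0} \<longleftrightarrow> (\<lambda>n::nat. g (- int n + 1)) summable_on {1..}"
    and "infsum g {..0} = (\<Sum>\<^sub>\<infinity>n\<in>{1::nat..}. g (- int n + 1))"
proof -
  have bij: "bij_betw (\<lambda>n::nat. - int n + 1) {1..} {..0}"
    by (rule bij_betwI[where g = "\<lambda>m. nat (1 - m)"]) auto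
  show "g summable_on {..0} \<longleftrightarrow> (\<lambda>n::nat. g (- int n + 1)) summable_on {1..}"
    by (rule summable_on_reindex_bij_betw[OF bij, symmetric])
  show "infsum g {..0} = (\<Sum>\<^sub>\<infinity>n\<in>{1::nat..}. g (- int n + 1))"
    by (rule infsum_reindex_bij_betw[OF bij, symmetric])
qed

lemma infsum_pos_int:
  fixes g :: "int \<Rightarrow> 'a::{comm_monoid_add,t2_space}"
  shows "infsum g {0<..} = (\<Sum>\<^sub>\<infinity>n\<in>{1::nat..}. g (int n))"
proof -
  have bij: "bij_betw int {1..} {0<..}"
    by (rule bij_betwI[where g = nat]) auto
  show ?thesis
    by (rule infsum_reindex_bij_betw[OF bij, symmetric])
qed

lemma laurent_weighted_bound:
  assumes a: "laurent_at_infinity F a" and neg: "(\<lambda>n. norm (a n)) summable_on {..0}" and \<rho>: "\<rho> \<ge> 1"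
  shows "(\<lambda>n. norm (a n) * \<rho> powi n) summable_on UNIV"
    and "(\<Sum>\<^sub>\<infinity>n. norm (a n) * \<rho> powi n)
      \<le> (\<Sum>\<^sub>\<infinity>n\<in>{0<..}. norm (a n) * \<rho> powi n) + (\<Sum>\<^sub>\<infinity>n\<in>{..0}. norm (a n))"
proof -
  have pos: "(\<lambda>n. norm (a n) * \<rho> powi n) summable_on {0<..}"
    using laurent_at_infinity_weighted_summable[OF a] \<rho> by simp
  have le: "norm (a n) * \<rho> powi n \<le> norm (a n)" if "n \<in> {..0}" for n
  proof -
    have "\<rho> powi n = inverse (\<rho> ^ nat (- n))"
      using that by (auto simp: power_int_def power_inverse)
    also have "\<dots> \<le> 1"
      using \<rho> by (simp add: inverse_le_1_iff one_le_power)
    finally show ?thesis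
      by (simp add: mult_left_le)
  qed
  have neg': "(\<lambda>n. norm (a n) * \<rho> powi n) summable_on {..0}"
    by (rule summable_on_comparison_test[OF neg]) (use le \<rho> in auto)
  have UNIV_int_eq: "UNIV = {0<..} \<union> {..0::int}"
    by auto
  show "(\<lambda>n. norm (a n) * \<rho> powi n) summable_on UNIV"
    unfolding UNIV_int_eq by (intro summable_on_Un_disjoint pos neg') auto
  show "(\<Sum>\<^sub>\<infinity>n. norm (a n) * \<rho> powi n)
      \<le> (\<Sum>\<^sub>\<infinity>n\<in>{0<..}. norm (a n) * \<rho> powi n) + (\<Sum>\<^sub>\<infinity>n\<in>{..0}. norm (a n))"
    unfolding UNIV_int_eq
    by (subst infsum_Un_disjoint[OF pos neg']) (auto intro!: infsum_mono neg' neg le)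
qed

section \<open>Tameness and power boundedness of Toeplitz operators\<close>

theorem corollary6p8:
  fixes U :: "complex option set" and F :: "complex \<Rightarrow> complex" and a :: "int \<Rightarrow> complex"
  assumes "simply_connected_nhd_infinity U"
    and "F holomorphic_on finite_part U"
    and "laurent_at_infinity F a"
  shows "((\<lambda>n::nat. norm (a (- int n + 1))) summable_on {1..} \<longrightarrow>
            strongly_tame scale_fun entire entire_norm (toeplitz U F) \<and>
            m_topologizable scale_fun entire entire_norm (toeplitz U F)) \<and>
         ((SUP p\<in>{1::nat..}. \<Sum>\<^sub>\<infinity>n\<in>{1::nat..}. ennreal (norm (a (int n)) * exp (real p * real n))) +
            (\<Sum>\<^sub>\<infinity>n\<in>{1::nat..}. ennreal (norm (a (- int n + 1)))) \<le> 1 \<longrightarrow>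
            power_bounded scale_fun entire entire_norm (toeplitz U F))"
proof (intro conjI impI)
  have U: "openin riemann_sphere U" "None \<in> U"
    using assms(1) by (auto simp: simply_connected_nhd_infinity_def)
  note norm_le = toeplitz_norm_le[OF U assms(2,3)]
  note lin = toeplitz_linear_operator[OF U assms(2,3)]
  interpret seminormed_space entire entire_norm
    by (rule entire_seminormed_space)
  let ?A = "\<lambda>p. \<Sum>\<^sub>\<infinity>n. norm (a n) * exp (real p) powi n"
  let ?pos = "\<lambda>p. \<Sum>\<^sub>\<infinity>n\<in>{0<..}. norm (a n) * exp (real p) powi n"
  let ?neg = "\<Sum>\<^sub>\<infinity>n\<in>{..0}. norm (a n)"
  {
    assume "(\<lambda>n::nat. norm (a (- int n + 1))) summable_on {1..}"
    then have neg: "(\<lambda>n. norm (a n)) summable_on {..0}"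
      by (simp add: infsum_nonpos_int(1))
    have "\<exists>C>0. \<forall>f\<in>entire. entire_norm p (toeplitz U F f) \<le> C * entire_norm p f" for p
    proof (intro exI conjI ballI)
      \<comment> \<open>adding 1 keeps the constant positive when all coefficients vanish\<close>
      show "0 < ?A p + 1"
        by (intro add_nonneg_pos infsum_nonneg) auto
      fix f assume f: "f \<in> entire"
      have "entire_norm p (toeplitz U F f) \<le> ?A p * entire_norm p f"
        by (intro norm_le laurent_weighted_bound[OF assms(3) neg] f) simp
      also have "\<dots> \<le> (?A p + 1) * entire_norm p f"
        using entire_norm_nonneg[OF f] by (intro mult_right_mono) auto
      finally show "entire_norm p (toeplitz U F f) \<le> (?A p + 1) * entire_norm p f" .
    qed
    with lin show "strongly_tame scale_fun entire entire_norm (toeplitz U F)"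
      by (simp add: strongly_tame_def)
    then show "m_topologizable scale_fun entire entire_norm (toeplitz U F)"
      by (rule strongly_tame_imp_m_topologizable)
  next
    assume le1: "(SUP p\<in>{1::nat..}. \<Sum>\<^sub>\<infinity>n\<in>{1::nat..}. ennreal (norm (a (int n)) * exp (real p * real n))) +
            (\<Sum>\<^sub>\<infinity>n\<in>{1::nat..}. ennreal (norm (a (- int n + 1)))) \<le> 1"
    have negE: "(\<Sum>\<^sub>\<infinity>n\<in>{..0}. ennreal (norm (a n))) = (\<Sum>\<^sub>\<infinity>n\<in>{1::nat..}. ennreal (norm (a (- int n + 1))))"
      by (rule infsum_nonpos_int(2))
    have le1': "(\<Sum>\<^sub>\<infinity>n\<in>{0<..}. ennreal (norm (a n) * exp (real p) powi n)) + (\<Sum>\<^sub>\<infinity>n\<in>{..0}. ennreal (norm (a n))) \<le> 1"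
      if "p \<ge> 1" for p
    proof -
      have "(\<Sum>\<^sub>\<infinity>n\<in>{0<..}. ennreal (norm (a n) * exp (real p) powi n))
          = (\<Sum>\<^sub>\<infinity>n\<in>{1::nat..}. ennreal (norm (a (int n)) * exp (real p * real n)))"
        unfolding infsum_pos_int by (simp add: exp_of_nat2_mult)
      also have "\<dots> \<le> (SUP p\<in>{1::nat..}. \<Sum>\<^sub>\<infinity>n\<in>{1::nat..}. ennreal (norm (a (int n)) * exp (real p * real n)))"
        using that by (intro SUP_upper) simp
      finally show ?thesis
        unfolding negE using le1 by (meson add_right_mono order_trans)
    qed
    have negfin: "(\<Sum>\<^sub>\<infinity>n\<in>{..0}. ennreal (norm (a n))) < \<infinity>"
      using order_trans[OF add_increasing[OF zero_le order_refl] le1'[of 1]]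
        le_less_trans[OF _ ennreal_one_less_top] by simp
    have neg: "(\<lambda>n. norm (a n)) summable_on {..0}"
      by (rule summable_on_of_ennreal_infsum[OF _ negfin]) simp
    show "power_bounded scale_fun entire entire_norm (toeplitz U F)"
    proof (rule contractive_imp_power_bounded[OF lin])
      fix p :: nat and f assume p: "p \<ge> 1" and f: "f \<in> entire"
      have posfin: "(\<Sum>\<^sub>\<infinity>n\<in>{0<..}. ennreal (norm (a n) * exp (real p) powi n)) < \<infinity>"
        using order_trans[OF add_increasing2[OF zero_le order_refl] le1'[OF p]]
          le_less_trans[OF _ ennreal_one_less_top] by simp
      have "ennreal (?pos p + ?neg) = ennreal (?pos p) + ennreal ?neg"
        by (intro ennreal_plus infsum_nonneg) auto
      also have "\<dots> \<le> 1"
        using le1'[OF p] by (simp add: ennreal_infsum[OF _ negfin] ennreal_infsum[OF _ posfin])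
      finally have "?pos p + ?neg \<le> 1" by simp
      moreover have "?A p \<le> ?pos p + ?neg"
        by (intro laurent_weighted_bound(2)[OF assms(3) neg]) simp
      ultimately have A1: "?A p \<le> 1" by simp
      have "entire_norm p (toeplitz U F f) \<le> ?A p * entire_norm p f"
        by (intro norm_le laurent_weighted_bound[OF assms(3) neg] f) simp
      also have "\<dots> \<le> 1 * entire_norm p f"
        using A1 entire_norm_nonneg[OF f] by (intro mult_right_mono)
      finally show "entire_norm p (toeplitz U F f) \<le> entire_norm p f" by simp
    qed
  }
qed

end
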